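(* For every cardinal $\mathfrak m$, there exists a family $\{K_i : i\in I\}$ of bounded lattices with $|I|=\mathfrak m$ such that every $K_i$ is simple and the family is mutually rigid.
   Context: A family $\{K_i : i\in I\}$ of bounded lattices is called mutually rigid if, for all $i\neq j$ in $I$, there is no $\{0,1\}$-embedding of $K_i$ into $K_j$ (a $\{0,1\}$-embedding is an injective lattice homomorphism preserving the least and greatest elements). A lattice is simple if it has exactly two congruences (the trivial and the total one). *)

theory Defs
  imports Main
begin

definition is_lub :: "'a set \<Rightarrow> ('a \<Rightarrow> 'a \<Rightarrow> bool) \<Rightarrow> 'a \<Rightarrow> 'a \<Rightarrow> 'a \<Rightarrow> bool" where
  "is_lub A le x y z \<longleftrightarrow> z \<in> A \<and> le x z \<and> le y z \<and>
     (\<forall>w\<in>A. le x w \<and> le y w \<longrightarrow> le z w)"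

definition is_glb :: "'a set \<Rightarrow> ('a \<Rightarrow> 'a \<Rightarrow> bool) \<Rightarrow> 'a \<Rightarrow> 'a \<Rightarrow> 'a \<Rightarrow> bool" where
  "is_glb A le x y z \<longleftrightarrow> z \<in> A \<and> le z x \<and> le z y \<and>
     (\<forall>w\<in>A. le w x \<and> le w y \<longrightarrow> le w z)"

definition is_lattice :: "'a set \<Rightarrow> ('a \<Rightarrow> 'a \<Rightarrow> bool) \<Rightarrow> bool" where
  "is_lattice A le \<longleftrightarrow>
     (\<forall>x\<in>A. le x x) \<and>
     (\<forall>x\<in>A. \<forall>y\<in>A. le x y \<and> le y x \<longrightarrow> x = y) \<and>
     (\<forall>x\<in>A. \<forall>y\<in>A. \<forall>z\<in>A. le x y \<and> le y z \<longrightarrow> le x z) \<and>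
     (\<forall>x\<in>A. \<forall>y\<in>A. (\<exists>z. is_lub A le x y z) \<and> (\<exists>z. is_glb A le x y z))"

definition ljoin :: "'a set \<Rightarrow> ('a \<Rightarrow> 'a \<Rightarrow> bool) \<Rightarrow> 'a \<Rightarrow> 'a \<Rightarrow> 'a" where
  "ljoin A le x y = (THE z. is_lub A le x y z)"

definition lmeet :: "'a set \<Rightarrow> ('a \<Rightarrow> 'a \<Rightarrow> bool) \<Rightarrow> 'a \<Rightarrow> 'a \<Rightarrow> 'a" where
  "lmeet A le x y = (THE z. is_glb A le x y z)"

definition is_bottom :: "'a set \<Rightarrow> ('a \<Rightarrow> 'a \<Rightarrow> bool) \<Rightarrow> 'a \<Rightarrow> bool" where
  "is_bottom A le b \<longleftrightarrow> b \<in> A \<and> (\<forall>x\<in>A. le b x)"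

definition is_top :: "'a set \<Rightarrow> ('a \<Rightarrow> 'a \<Rightarrow> bool) \<Rightarrow> 'a \<Rightarrow> bool" where
  "is_top A le t \<longleftrightarrow> t \<in> A \<and> (\<forall>x\<in>A. le x t)"

definition bounded_lattice :: "'a set \<Rightarrow> ('a \<Rightarrow> 'a \<Rightarrow> bool) \<Rightarrow> bool" where
  "bounded_lattice A le \<longleftrightarrow> is_lattice A le \<and> (\<exists>b. is_bottom A le b) \<and> (\<exists>t. is_top A le t)"

definition lbot :: "'a set \<Rightarrow> ('a \<Rightarrow> 'a \<Rightarrow> bool) \<Rightarrow> 'a" where
  "lbot A le = (THE b. is_bottom A le b)"

definition ltop :: "'a set \<Rightarrow> ('a \<Rightarrow> 'a \<Rightarrow> bool) \<Rightarrow> 'a" where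
  "ltop A le = (THE t. is_top A le t)"

definition lattice_congruence :: "'a set \<Rightarrow> ('a \<Rightarrow> 'a \<Rightarrow> bool) \<Rightarrow> ('a \<times> 'a) set \<Rightarrow> bool" where
  "lattice_congruence A le \<theta> \<longleftrightarrow> equiv A \<theta> \<and>
     (\<forall>x\<in>A. \<forall>y\<in>A. \<forall>x'\<in>A. \<forall>y'\<in>A. (x, x') \<in> \<theta> \<and> (y, y') \<in> \<theta> \<longrightarrow>
        (ljoin A le x y, ljoin A le x' y') \<in> \<theta> \<and> (lmeet A le x y, lmeet A le x' y') \<in> \<theta>)"

definition simple_lattice :: "'a set \<Rightarrow> ('a \<Rightarrow> 'a \<Rightarrow> bool) \<Rightarrow> bool" where
  "simple_lattice A le \<longleftrightarrow> card {\<theta>. lattice_congruence A le \<theta>} = 2"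

definition zero_one_embedding ::
  "'a set \<Rightarrow> ('a \<Rightarrow> 'a \<Rightarrow> bool) \<Rightarrow> 'b set \<Rightarrow> ('b \<Rightarrow> 'b \<Rightarrow> bool) \<Rightarrow> ('a \<Rightarrow> 'b) \<Rightarrow> bool" where
  "zero_one_embedding A le B le' f \<longleftrightarrow>
     f ` A \<subseteq> B \<and> inj_on f A \<and>
     (\<forall>x\<in>A. \<forall>y\<in>A. f (ljoin A le x y) = ljoin B le' (f x) (f y) \<and>
                    f (lmeet A le x y) = lmeet B le' (f x) (f y)) \<and>
     f (lbot A le) = lbot B le' \<and> f (ltop A le) = ltop B le'"

end

theory Submission
  imports Defs "HOL-Library.Extended" "HOL-Library.Product_Lexorder"
begin

text \<open>
  Over a chain with \<open>0\<close> and \<open>1\<close> we adjoin to each pair \<open>a < b\<close> of a chosen binary relation,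
  where \<open>b\<close> must not cover \<open>a\<close>, one or
  two side elements \<open>e\<close> whose only comparabilities are \<open>x \<le> e\<close> for \<open>x\<close> below \<open>a\<close> and \<open>e \<le> x\<close> for
  \<open>x\<close> above \<open>b\<close>. This is always a lattice. If every point \<open>c < 1\<close> has a side element to \<open>1\<close>, and
  \<open>0\<close> has two, then it is simple, and a \<open>{0,1}\<close>-embedding between two such lattices restricts to a
  strictly increasing map of the chains that respects the relation and the multiplicities.

  Take the chain \<open>X \<times> \<omega>\<close>, bounds added, for a well-order \<open>X\<close> with a greatest element. The relation
  can encode a countable ladder below each \<open>d \<in> X\<close> of cofinality \<open>\<omega>\<close>, with the positions on the
  ladder, and this makes the chain rigid: a strictly increasing \<open>g\<close> that preserves the ladders fixes
  the supremum of each of its orbits, hence everything. A marker attached to one point of \<open>X\<close> is then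
  preserved by any embedding, so different markers give mutually rigid lattices.
\<close>

section \<open>Lattices of segments over a bounded chain\<close>

type_synonym 'c segment = "'c \<times> 'c \<times> bool"

abbreviation lo :: "'c segment \<Rightarrow> 'c" where "lo \<equiv> fst"
abbreviation hi :: "'c segment \<Rightarrow> 'c" where "hi u \<equiv> fst (snd u)"

text \<open>A triple \<open>(c, c, False)\<close> is the chain point \<open>c\<close>; a triple \<open>(a, b, k)\<close> with \<open>a < b\<close> is a side
  element, where \<open>k\<close> distinguishes parallel ones.\<close>

definition pt :: "'c \<Rightarrow> 'c segment" where
  "pt c = (c, c, False)"

definition seg_le :: "'c::linorder segment \<Rightarrow> 'c segment \<Rightarrow> bool" where
  "seg_le u v \<longleftrightarrow> u = v \<or> hi u \<le> lo v"

definition seg_join :: "'c::linorder segment \<Rightarrow> 'c segment \<Rightarrow> 'c segment" where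
  "seg_join u v = (if seg_le u v then v else if seg_le v u then u else pt (max (hi u) (hi v)))"

definition seg_meet :: "'c::linorder segment \<Rightarrow> 'c segment \<Rightarrow> 'c segment" where
  "seg_meet u v = (if seg_le u v then u else if seg_le v u then v else pt (min (lo u) (lo v)))"

text \<open>The order is transported along \<phi>, because the theorem prescribes the type of the
  lattice elements.\<close>

definition coded_le :: "('c::linorder segment \<Rightarrow> 'v) \<Rightarrow> 'v \<Rightarrow> 'v \<Rightarrow> bool" where
  "coded_le \<phi> x y \<longleftrightarrow> seg_le (inv \<phi> x) (inv \<phi> y)"

lemma pt_simps [simp]: "fst (pt c) = c" "snd (pt c) = (c, False)" "pt c = pt d \<longleftrightarrow> c = d"
  by (auto simp: pt_def)

lemma seg_le_pt_pt [simp]: "seg_le (pt c) (pt d) \<longleftrightarrow> c \<le> d"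
  by (auto simp: seg_le_def)

text \<open>A point \<open>z\<close> strictly between the ends is incomparable to the side element,
  so their join and meet recover both ends.\<close>

locale seg_system =
  fixes A :: "'p::linorder extended segment set"
    and \<phi> :: "'p extended segment \<Rightarrow> 'v"
  assumes inj: "inj \<phi>"
    and pt_in: "pt c \<in> A"
    and seg_cases: "(a, b, k) \<in> A \<Longrightarrow> a = b \<and> \<not> k \<or> (\<exists>z. a < z \<and> z < b)"
    and upper_in: "c \<noteq> Pinf \<Longrightarrow> (c, Pinf, False) \<in> A"
    and full_in: "(Minf, Pinf, True) \<in> A"
begin

section \<open>Lattice structure and bounds\<close>

lemma lo_le_hi: "u \<in> A \<Longrightarrow> lo u \<le> hi u"
  using seg_cases[of "lo u" "hi u" "snd (snd u)"] by auto

lemma seg_le_trans: "seg_le u v \<Longrightarrow> seg_le v w \<Longrightarrow> v \<in> A \<Longrightarrow> seg_le u w"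
  using lo_le_hi[of v] by (auto simp: seg_le_def)

lemma seg_le_antisym:
  assumes "u \<in> A" "v \<in> A" "seg_le u v" "seg_le v u"
  shows "u = v"
proof (rule ccontr)
  assume "u \<noteq> v"
  with assms have "hi u \<le> lo v" "hi v \<le> lo u" by (auto simp: seg_le_def)
  with assms lo_le_hi have "hi u = lo u" "hi v = lo v" "lo u = lo v"
    by (meson order.antisym order.trans)+
  moreover have "(lo u, hi u, snd (snd u)) \<in> A" "(lo v, hi v, snd (snd v)) \<in> A"
    using assms by simp_all
  ultimately have "u = v"
    using seg_cases[of "lo v" "lo v"] by (force simp: prod_eq_iff)
  with \<open>u \<noteq> v\<close> show False ..
qed

lemma seg_le_refl [simp]: "seg_le u u"
  by (simp add: seg_le_def)

lemma seg_meet_idem [simp]: "seg_meet u u = u"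
  by (simp add: seg_meet_def)

lemma join_in: "u \<in> A \<Longrightarrow> v \<in> A \<Longrightarrow> seg_join u v \<in> A"
  by (auto simp: seg_join_def pt_in)

lemma meet_in: "u \<in> A \<Longrightarrow> v \<in> A \<Longrightarrow> seg_meet u v \<in> A"
  by (auto simp: seg_meet_def pt_in)

lemma join_upper: "seg_le u (seg_join u v)" "seg_le v (seg_join u v)"
  by (auto simp: seg_join_def) (auto simp: seg_le_def)

lemma meet_lower: "seg_le (seg_meet u v) u" "seg_le (seg_meet u v) v"
  by (auto simp: seg_meet_def) (auto simp: seg_le_def min_def)

text \<open>A common upper bound of incomparable \<open>u\<close> and \<open>v\<close> differs from
  both, so its lower end is at least both upper ends.\<close>

lemma join_least:
  assumes "seg_le u w" "seg_le v w"
  shows "seg_le (seg_join u v) w"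
proof (cases "seg_le u v \<or> seg_le v u")
  case True
  with assms show ?thesis by (auto simp: seg_join_def)
next
  case False
  with assms have "u \<noteq> w" "v \<noteq> w" by auto
  with assms False show ?thesis by (simp add: seg_join_def) (simp add: seg_le_def)
qed

lemma meet_greatest:
  assumes "seg_le w u" "seg_le w v"
  shows "seg_le w (seg_meet u v)"
proof (cases "seg_le u v \<or> seg_le v u")
  case True
  with assms show ?thesis by (auto simp: seg_meet_def)
next
  case False
  with assms have "u \<noteq> w" "v \<noteq> w" by auto
  with assms False show ?thesis by (simp add: seg_meet_def) (simp add: seg_le_def)
qed

lemma le_code [simp]: "coded_le \<phi> (\<phi> u) (\<phi> v) \<longleftrightarrow> seg_le u v"
  by (simp add: coded_le_def inj)

lemma code_eq [simp]: "\<phi> u = \<phi> v \<longleftrightarrow> u = v"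
  using inj by (auto dest: injD)

lemma code_in [simp]: "\<phi> u \<in> \<phi> ` A \<longleftrightarrow> u \<in> A"
  by auto

lemma is_lub_join:
  "u \<in> A \<Longrightarrow> v \<in> A \<Longrightarrow> is_lub (\<phi> ` A) (coded_le \<phi>) (\<phi> u) (\<phi> v) (\<phi> (seg_join u v))"
  by (auto simp: is_lub_def join_in join_upper join_least)

lemma is_glb_meet:
  "u \<in> A \<Longrightarrow> v \<in> A \<Longrightarrow> is_glb (\<phi> ` A) (coded_le \<phi>) (\<phi> u) (\<phi> v) (\<phi> (seg_meet u v))"
  by (auto simp: is_glb_def meet_in meet_lower meet_greatest)

lemma ljoin_code [simp]:
  assumes "u \<in> A" "v \<in> A"
  shows "ljoin (\<phi> ` A) (coded_le \<phi>) (\<phi> u) (\<phi> v) = \<phi> (seg_join u v)"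
  unfolding ljoin_def
proof (rule the_equality)
  show "is_lub (\<phi> ` A) (coded_le \<phi>) (\<phi> u) (\<phi> v) (\<phi> (seg_join u v))"
    by (rule is_lub_join[OF assms])
  fix z assume "is_lub (\<phi> ` A) (coded_le \<phi>) (\<phi> u) (\<phi> v) z"
  then show "z = \<phi> (seg_join u v)"
    using assms join_in[OF assms]
    by (auto simp: is_lub_def join_upper join_least intro!: seg_le_antisym)
qed

lemma lmeet_code [simp]:
  assumes "u \<in> A" "v \<in> A"
  shows "lmeet (\<phi> ` A) (coded_le \<phi>) (\<phi> u) (\<phi> v) = \<phi> (seg_meet u v)"
  unfolding lmeet_def
proof (rule the_equality)
  show "is_glb (\<phi> ` A) (coded_le \<phi>) (\<phi> u) (\<phi> v) (\<phi> (seg_meet u v))"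
    by (rule is_glb_meet[OF assms])
  fix z assume "is_glb (\<phi> ` A) (coded_le \<phi>) (\<phi> u) (\<phi> v) z"
  then show "z = \<phi> (seg_meet u v)"
    using assms meet_in[OF assms]
    by (auto simp: is_glb_def meet_lower meet_greatest intro!: seg_le_antisym)
qed

lemma is_lattice_code: "is_lattice (\<phi> ` A) (coded_le \<phi>)"
  unfolding is_lattice_def
proof (intro conjI)
  show "\<forall>x\<in>\<phi> ` A. \<forall>y\<in>\<phi> ` A. (\<exists>z. is_lub (\<phi> ` A) (coded_le \<phi>) x y z) \<and> (\<exists>z. is_glb (\<phi> ` A) (coded_le \<phi>) x y z)"
    using is_lub_join is_glb_meet by blast
qed (auto dest: seg_le_antisym intro: seg_le_trans)

lemma bot_least: "u \<in> A \<Longrightarrow> seg_le (pt Minf) u"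
  by (auto simp: seg_le_def)

lemma top_greatest: "u \<in> A \<Longrightarrow> seg_le u (pt Pinf)"
  by (auto simp: seg_le_def)

lemma is_bottom_code: "is_bottom (\<phi> ` A) (coded_le \<phi>) (\<phi> (pt Minf))"
  by (auto simp: is_bottom_def pt_in bot_least)

lemma is_top_code: "is_top (\<phi> ` A) (coded_le \<phi>) (\<phi> (pt Pinf))"
  by (auto simp: is_top_def pt_in top_greatest)

lemma bounded_lattice_code: "bounded_lattice (\<phi> ` A) (coded_le \<phi>)"
  unfolding bounded_lattice_def using is_lattice_code is_bottom_code is_top_code by blast

lemma lbot_code: "lbot (\<phi> ` A) (coded_le \<phi>) = \<phi> (pt Minf)"
  unfolding lbot_def
  by (rule the_equality, rule is_bottom_code)
    (auto simp: is_bottom_def pt_in bot_least intro!: seg_le_antisym)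

lemma ltop_code: "ltop (\<phi> ` A) (coded_le \<phi>) = \<phi> (pt Pinf)"
  unfolding ltop_def
  by (rule the_equality, rule is_top_code)
    (auto simp: is_top_def pt_in top_greatest intro!: seg_le_antisym)

section \<open>Congruences and simplicity\<close>

lemma congruence_join:
  assumes "lattice_congruence (\<phi> ` A) (coded_le \<phi>) \<theta>" "(\<phi> u, \<phi> u') \<in> \<theta>" "w \<in> A"
  shows "(\<phi> (seg_join u w), \<phi> (seg_join u' w)) \<in> \<theta>"
proof -
  have e: "equiv (\<phi> ` A) \<theta>" using assms by (simp add: lattice_congruence_def)
  then have "(\<phi> w, \<phi> w) \<in> \<theta>" "\<phi> u \<in> \<phi> ` A" "\<phi> u' \<in> \<phi> ` A"
    using assms by (auto simp: equiv_def refl_on_def)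
  then show ?thesis using assms unfolding lattice_congruence_def
    by (metis code_in ljoin_code)
qed

lemma congruence_meet:
  assumes "lattice_congruence (\<phi> ` A) (coded_le \<phi>) \<theta>" "(\<phi> u, \<phi> u') \<in> \<theta>" "w \<in> A"
  shows "(\<phi> (seg_meet u w), \<phi> (seg_meet u' w)) \<in> \<theta>"
proof -
  have e: "equiv (\<phi> ` A) \<theta>" using assms by (simp add: lattice_congruence_def)
  then have "(\<phi> w, \<phi> w) \<in> \<theta>" "\<phi> u \<in> \<phi> ` A" "\<phi> u' \<in> \<phi> ` A"
    using assms by (auto simp: equiv_def refl_on_def)
  then show ?thesis using assms unfolding lattice_congruence_def
    by (metis code_in lmeet_code)
qed

text \<open>Meeting the pair with \<open>u\<close> identifies the bottom with
  \<open>u\<close>.\<close>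

lemma congruence_bot_top_imp_total:
  assumes \<theta>: "lattice_congruence (\<phi> ` A) (coded_le \<phi>) \<theta>"
    and bt: "(\<phi> (pt Minf), \<phi> (pt Pinf)) \<in> \<theta>"
  shows "\<theta> = \<phi> ` A \<times> \<phi> ` A"
proof -
  have e: "equiv (\<phi> ` A) \<theta>" using \<theta> by (simp add: lattice_congruence_def)
  have "(\<phi> (pt Minf), \<phi> u) \<in> \<theta>" if "u \<in> A" for u
  proof -
    have "seg_meet (pt Minf) u = pt Minf" "seg_meet (pt Pinf) u = u"
      using top_greatest[OF that] bot_least[OF that] seg_le_antisym[OF that pt_in[of Pinf]]
      by (auto simp: seg_meet_def)
    then show ?thesis using congruence_meet[OF \<theta> bt that] by simp
  qed
  note * = this
  have "(\<phi> u, \<phi> v) \<in> \<theta>" if "u \<in> A" "v \<in> A" for u v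
    using *[OF that(1)] *[OF that(2)] e by (meson equiv_def symD transD)
  moreover have "\<theta> \<subseteq> \<phi> ` A \<times> \<phi> ` A" using e by (simp add: equiv_def)
  ultimately show ?thesis by auto
qed

text \<open>Joining with a side element from \<open>c\<close> to the top identifies that element
  with the top. Meets and joins with the two full side elements then carry the identification to the
  bottom.\<close>

lemma congruence_pt_imp_total:
  assumes \<theta>: "lattice_congruence (\<phi> ` A) (coded_le \<phi>) \<theta>"
    and cd: "(\<phi> (pt c), \<phi> (pt d)) \<in> \<theta>" "c < d"
  shows "\<theta> = \<phi> ` A \<times> \<phi> ` A"
proof (rule congruence_bot_top_imp_total[OF \<theta>])
  have e: "equiv (\<phi> ` A) \<theta>" using \<theta> by (simp add: lattice_congruence_def)
  have trans: "(x, z) \<in> \<theta>" if "(x, y) \<in> \<theta>" "(y, z) \<in> \<theta>" for x y z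
    using e that by (meson equiv_def transD)
  let ?e = "\<lambda>k. (Minf, Pinf, k) :: 'p extended segment"
  have c: "c \<noteq> Pinf" using cd by auto
  have eA: "?e k \<in> A" for k using full_in upper_in[of Minf] by (cases k) auto
  have up: "(\<phi> (c, Pinf, k), \<phi> (pt Pinf)) \<in> \<theta>" if "(c, Pinf, k) \<in> A" for k
    using congruence_join[OF \<theta> cd(1) that] cd(2) c
    by (auto simp: seg_join_def seg_le_def pt_def split: if_splits)
  show "(\<phi> (pt Minf), \<phi> (pt Pinf)) \<in> \<theta>"
  proof (cases "c = Minf")
    case True
    then have "(\<phi> (?e k), \<phi> (pt Pinf)) \<in> \<theta>" for k using up[of k] eA[of k] by simp
    from congruence_meet[OF \<theta> this[of False] eA[of True]] this[of True]
    have "(\<phi> (pt Minf), \<phi> (?e True)) \<in> \<theta>"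
      by (auto simp: seg_meet_def seg_le_def split: if_splits)
    with \<open>\<And>k. (\<phi> (?e k), \<phi> (pt Pinf)) \<in> \<theta>\<close> show ?thesis by (blast intro: trans)
  next
    case False
    have "(\<phi> (pt Minf), \<phi> (?e k)) \<in> \<theta>" for k
      using congruence_meet[OF \<theta> up[OF upper_in[OF c]] eA[of k]] False c
      by (auto simp: seg_meet_def seg_le_def split: if_splits)
    note * = this
    from congruence_join[OF \<theta> *[of False] eA[of True]]
    have "(\<phi> (?e True), \<phi> (pt Pinf)) \<in> \<theta>"
      by (auto simp: seg_join_def seg_le_def split: if_splits)
    with * show ?thesis by (blast intro: trans)
  qed
qed

text \<open>A point \<open>z\<close> strictly inside a side element reduces this to two points:
  meeting with \<open>pt b\<close> and then \<open>pt z\<close> if \<open>u\<close> is a side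
  element, joining with \<open>pt z\<close> if only \<open>v\<close> is.\<close>

lemma congruence_less_imp_total:
  assumes \<theta>: "lattice_congruence (\<phi> ` A) (coded_le \<phi>) \<theta>"
    and uv: "(\<phi> u, \<phi> v) \<in> \<theta>" "u \<in> A" "v \<in> A" "u \<noteq> v" "seg_le u v"
  shows "\<theta> = \<phi> ` A \<times> \<phi> ` A"
proof -
  obtain a b k where u: "u = (a, b, k)" by (cases u)
  obtain a' b' k' where v: "v = (a', b', k')" by (cases v)
  have ba': "b \<le> a'" using uv u v by (auto simp: seg_le_def)
  from seg_cases[of a b k] uv u consider (u) z where "a < z" "z < b" | "a = b" "\<not> k" by auto
  then show ?thesis
  proof cases
    case (u z)
    have "(\<phi> (seg_meet (seg_meet u (pt b)) (pt z)), \<phi> (seg_meet (seg_meet v (pt b)) (pt z))) \<in> \<theta>"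
      by (intro congruence_meet[OF \<theta>] uv pt_in)
    moreover have "seg_meet u (pt b) = u" "seg_meet u (pt z) = pt a"
      using u \<open>u = (a, b, k)\<close> by (auto simp: seg_meet_def seg_le_def pt_def)
    moreover have "seg_meet v (pt b) = pt b" "seg_meet (pt b) (pt z) = pt z"
      using u v ba' seg_cases[of a' b' k'] uv(3) by (auto simp: seg_meet_def seg_le_def pt_def)
    ultimately show ?thesis using congruence_pt_imp_total[OF \<theta> _ u(1)] by simp
  next
    case 2
    then have ua: "u = pt b" using u by (simp add: pt_def)
    from seg_cases[of a' b' k'] uv v consider (v) z where "a' < z" "z < b'" | "a' = b'" "\<not> k'" by auto
    then show ?thesis
    proof cases
      case (v z)
      have "(\<phi> (seg_join u (pt z)), \<phi> (seg_join v (pt z))) \<in> \<theta>"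
        by (intro congruence_join[OF \<theta>] uv pt_in)
      moreover have "seg_join u (pt z) = pt z" "seg_join v (pt z) = pt b'"
        using v ua ba' \<open>v = (a', b', k')\<close> by (auto simp: seg_join_def seg_le_def pt_def)
      ultimately show ?thesis using congruence_pt_imp_total[OF \<theta> _ v(2)] by simp
    next
      case 2
      then have "v = pt a'" using v by (simp add: pt_def)
      then show ?thesis using congruence_pt_imp_total[OF \<theta>, of b a'] uv ua ba' by force
    qed
  qed
qed

text \<open>Congruent elements are both congruent to their meet, so the comparable case
  decides.\<close>

lemma congruence_cases:
  assumes \<theta>: "lattice_congruence (\<phi> ` A) (coded_le \<phi>) \<theta>"
  shows "\<theta> = Id_on (\<phi> ` A) \<or> \<theta> = \<phi> ` A \<times> \<phi> ` A"
proof (rule disjCI)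
  assume not_total: "\<theta> \<noteq> \<phi> ` A \<times> \<phi> ` A"
  have e: "equiv (\<phi> ` A) \<theta>" using \<theta> by (simp add: lattice_congruence_def)
  have "u = v" if uv: "(\<phi> u, \<phi> v) \<in> \<theta>" "u \<in> A" "v \<in> A" for u v
  proof -
    have "(\<phi> (seg_meet u u), \<phi> (seg_meet v u)) \<in> \<theta>" "(\<phi> (seg_meet u v), \<phi> (seg_meet v v)) \<in> \<theta>"
      using congruence_meet[OF \<theta>] uv by blast+
    moreover have "seg_meet v u = seg_meet u v"
      using seg_le_antisym[OF uv(2,3)] by (auto simp: seg_meet_def min.commute)
    moreover have "sym \<theta>" using e by (simp add: equiv_def)
    ultimately have "(\<phi> (seg_meet u v), \<phi> u) \<in> \<theta>" "(\<phi> (seg_meet u v), \<phi> v) \<in> \<theta>"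
      by (auto dest: symD)
    then have "seg_meet u v = u" "seg_meet u v = v"
      using congruence_less_imp_total[OF \<theta> _ meet_in[OF uv(2,3)]] not_total meet_lower uv(2,3)
      by metis+
    then show ?thesis by simp
  qed
  note * = this
  show "\<theta> = Id_on (\<phi> ` A)"
  proof (intro equalityI subrelI)
    fix x y assume xy: "(x, y) \<in> \<theta>"
    with e obtain u v where "x = \<phi> u" "y = \<phi> v" "u \<in> A" "v \<in> A"
      by (auto simp: equiv_def)
    with xy *[of u v] show "(x, y) \<in> Id_on (\<phi> ` A)" by (simp add: Id_on_iff)
  next
    fix x y assume "(x, y) \<in> Id_on (\<phi> ` A)"
    with e show "(x, y) \<in> \<theta>" by (auto simp: equiv_def refl_on_def)
  qed
qed

lemma simple_lattice_code: "simple_lattice (\<phi> ` A) (coded_le \<phi>)"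
proof -
  have "lattice_congruence (\<phi> ` A) (coded_le \<phi>) (Id_on (\<phi> ` A))"
    by (auto simp: lattice_congruence_def equiv_def refl_on_def sym_def trans_def join_in meet_in)
  moreover have "lattice_congruence (\<phi> ` A) (coded_le \<phi>) (\<phi> ` A \<times> \<phi> ` A)"
    by (auto simp: lattice_congruence_def equiv_def refl_on_def sym_def trans_def join_in meet_in)
  ultimately have "{\<theta>. lattice_congruence (\<phi> ` A) (coded_le \<phi>) \<theta>} = {Id_on (\<phi> ` A), \<phi> ` A \<times> \<phi> ` A}"
    using congruence_cases by auto
  moreover have "pt Minf \<noteq> (pt Pinf :: 'p extended segment)" by simp
  then have "(\<phi> (pt Minf), \<phi> (pt Pinf)) \<in> \<phi> ` A \<times> \<phi> ` A" "(\<phi> (pt Minf), \<phi> (pt Pinf)) \<notin> Id_on (\<phi> ` A)"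
    by (simp_all add: pt_in Id_on_iff del: pt_simps)
  then have "Id_on (\<phi> ` A) \<noteq> \<phi> ` A \<times> \<phi> ` A" by metis
  ultimately show ?thesis unfolding simple_lattice_def by simp
qed

end

section \<open>Embeddings restricted to the chain\<close>

text \<open>A doubled pair has two distinct images with the same ends, so it lands on a doubled
  pair; a single side element may land on either copy.\<close>

lemma embedding_chain_map:
  fixes \<phi> :: "'p::linorder extended segment \<Rightarrow> 'v"
  assumes A: "seg_system A \<phi>" and B: "seg_system B \<phi>"
    and f: "zero_one_embedding (\<phi> ` A) (coded_le \<phi>) (\<phi> ` B) (coded_le \<phi>) f"
  obtains g where "strict_mono g" "g Minf = Minf" "g Pinf = Pinf"
    "\<And>a b k. (a, b, k) \<in> A \<Longrightarrow> a < b \<Longrightarrow> \<exists>k'. (g a, g b, k') \<in> B"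
    "\<And>a b k. (a, b, False) \<in> A \<Longrightarrow> (a, b, True) \<in> A \<Longrightarrow> (g a, g b, k) \<in> B"
proof -
  interpret A: seg_system A \<phi> by (rule A)
  interpret B: seg_system B \<phi> by (rule B)
  define h where "h u = inv \<phi> (f (\<phi> u))" for u
  have f_img: "f (\<phi> u) \<in> \<phi> ` B" if "u \<in> A" for u
    using f that by (auto simp: zero_one_embedding_def)
  have fh: "f (\<phi> u) = \<phi> (h u)" and hB: "h u \<in> B" if "u \<in> A" for u
    using f_img[OF that] A.inj by (auto simp: h_def)
  have h_inj: "u = v" if "h u = h v" "u \<in> A" "v \<in> A" for u v
  proof -
    have "f (\<phi> u) = f (\<phi> v)" using that fh by simp
    then show ?thesis using f that by (auto simp: zero_one_embedding_def dest: inj_onD)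
  qed
  have f_ops: "f (\<phi> (seg_join u v)) = ljoin (\<phi> ` B) (coded_le \<phi>) (f (\<phi> u)) (f (\<phi> v))"
    "f (\<phi> (seg_meet u v)) = lmeet (\<phi> ` B) (coded_le \<phi>) (f (\<phi> u)) (f (\<phi> v))"
    if "u \<in> A" "v \<in> A" for u v
    using f that by (simp_all add: zero_one_embedding_def)
  have h_join: "h (seg_join u v) = seg_join (h u) (h v)"
    and h_meet: "h (seg_meet u v) = seg_meet (h u) (h v)" if "u \<in> A" "v \<in> A" for u v
    using f_ops[OF that] fh[OF A.join_in[OF that]] fh[OF A.meet_in[OF that]] that
    by (simp_all add: fh hB)
  have h_bot: "h (pt Minf) = pt Minf" and h_top: "h (pt Pinf) = pt Pinf"
    using f by (simp_all add: zero_one_embedding_def A.lbot_code B.lbot_code A.ltop_code B.ltop_code h_def A.inj)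
  have le_meet: "seg_le u v \<longleftrightarrow> seg_meet u v = u" if "u \<in> A" "v \<in> A" for u v
    using A.meet_lower(2)[of u v] by (auto simp: seg_meet_def)
  have le_meet': "seg_le u v \<longleftrightarrow> seg_meet u v = u" if "u \<in> B" "v \<in> B" for u v
    using B.meet_lower(2)[of u v] by (auto simp: seg_meet_def)
  have h_le: "seg_le (h u) (h v) \<longleftrightarrow> seg_le u v" if "u \<in> A" "v \<in> A" for u v
    using le_meet[OF that] le_meet'[OF hB hB, OF that] h_meet[OF that] h_inj that A.meet_in by metis
  \<comment> \<open>A join or meet of incomparable elements lies on the chain, and every point \<open>c\<close> below the
    top is such a meet: that of the segments from \<open>c\<close> and from some \<open>d > c\<close> to the top.\<close>
  have "\<exists>c'. h (pt c) = pt c'" for c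
  proof (cases "c = Pinf")
    case False
    then obtain d where d: "c < d" "d < Pinf"
      using A.seg_cases[OF A.upper_in[OF False]] by auto
    let ?u = "(c, Pinf, False)" and ?v = "(d, Pinf, False)"
    have uv: "?u \<in> A" "?v \<in> A" using False d by (auto intro!: A.upper_in)
    have inc: "\<not> seg_le ?u ?v" "\<not> seg_le ?v ?u" using d False by (auto simp: seg_le_def)
    then have "seg_meet ?u ?v = pt c" using d by (auto simp: seg_meet_def min_def)
    then have "h (pt c) = seg_meet (h ?u) (h ?v)" using h_meet[OF uv] by metis
    then show ?thesis using inc h_le uv by (auto simp: seg_meet_def)
  qed (use h_top in auto)
  then obtain g where g: "h (pt c) = pt (g c)" for c by metis
  have "strict_mono g"
  proof (rule strict_monoI)
    fix c d :: "'p extended" assume cd: "c < d"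
    then have "g c \<le> g d" using h_le[of "pt c" "pt d"] by (simp add: A.pt_in g)
    moreover have "g c \<noteq> g d" using h_inj[of "pt c" "pt d"] cd by (auto simp: A.pt_in g)
    ultimately show "g c < g d" by simp
  qed
  moreover have "g Minf = Minf" "g Pinf = Pinf" using h_bot h_top g by simp_all
  moreover have h_seg: "\<exists>k'. h (a, b, k) = (g a, g b, k')" if ab: "(a, b, k) \<in> A" "a < b" for a b k
  proof -
    obtain z where z: "a < z" "z < b" using A.seg_cases[OF ab(1)] ab(2) by auto
    let ?u = "(a, b, k)"
    have inc: "\<not> seg_le ?u (pt z)" "\<not> seg_le (pt z) ?u" using z by (auto simp: seg_le_def pt_def)
    then have "seg_join ?u (pt z) = pt b" "seg_meet ?u (pt z) = pt a"
      using z by (auto simp: seg_join_def seg_meet_def max_def min_def)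
    then have *: "seg_join (h ?u) (pt (g z)) = pt (g b)" "seg_meet (h ?u) (pt (g z)) = pt (g a)"
      using h_join[OF ab(1) A.pt_in] h_meet[OF ab(1) A.pt_in] g by metis+
    \<comment> \<open>The image stays incomparable to \<open>pt (g z)\<close>, so its join and meet
      with that point are the points at its own ends.\<close>
    have inc': "\<not> seg_le (h ?u) (pt (g z))" "\<not> seg_le (pt (g z)) (h ?u)"
      using inc h_le[OF ab(1) A.pt_in] h_le[OF A.pt_in ab(1)] g by metis+
    then have "max (hi (h ?u)) (g z) = g b" "min (lo (h ?u)) (g z) = g a"
      using * by (simp_all add: seg_join_def seg_meet_def)
    moreover have "g z < hi (h ?u)" "lo (h ?u) < g z"
      using inc' by (auto simp: seg_le_def)
    ultimately show ?thesis by (metis max.strict_order_iff min.strict_order_iff max.commute prod.collapse)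
  qed
  moreover have "\<exists>k'. (g a, g b, k') \<in> B" if "(a, b, k) \<in> A" "a < b" for a b k
    using h_seg[OF that] hB[OF that(1)] by metis
  moreover have "(g a, g b, k) \<in> B" if ab: "(a, b, False) \<in> A" "(a, b, True) \<in> A" for a b k
  proof -
    have "a < b" using A.seg_cases[OF ab(2)] by auto
    then obtain k1 k2 where k: "h (a, b, False) = (g a, g b, k1)" "h (a, b, True) = (g a, g b, k2)"
      using h_seg ab by metis
    then have "k1 \<noteq> k2" using h_inj[OF _ ab] by auto
    then show ?thesis using hB[OF ab(1)] hB[OF ab(2)] k by (cases k; cases k1; cases k2) auto
  qed
  ultimately show thesis using that by blast
qed

section \<open>A rigid well-ordered structure\<close>

text \<open>A sequence cofinal below \<open>d\<close>, not assumed monotone; a successor has one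
  too, a constant sequence.\<close>

definition ladder :: "'x::linorder \<Rightarrow> (nat \<Rightarrow> 'x) \<Rightarrow> bool" where
  "ladder d s \<longleftrightarrow> (\<forall>n. s n < d) \<and> (\<forall>y<d. \<exists>n. y \<le> s n)"

text \<open>Without a ladder at \<open>d\<close> the value is arbitrary, hence the later guards
  \<open>ladder d (some_ladder d)\<close>.\<close>

definition some_ladder :: "'x::linorder \<Rightarrow> nat \<Rightarrow> 'x" where
  "some_ladder d = (SOME s. ladder d s)"

lemma ladder_some_ladder: "ladder d s \<Longrightarrow> ladder d (some_ladder d)"
  unfolding some_ladder_def by (rule someI[of "ladder d"])

lemma strict_mono_wellorder_increasing:
  fixes g :: "'x::wellorder \<Rightarrow> 'x"
  assumes "strict_mono g"
  shows "x \<le> g x"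
proof (induction x rule: less_induct)
  case (less x)
  show ?case
  proof (rule ccontr)
    assume "\<not> x \<le> g x"
    then have "g (g x) < g x" "g x \<le> g (g x)"
      using assms less by (auto simp: strict_mono_less)
    then show False by simp
  qed
qed

text \<open>If \<open>g\<close> moves \<open>x\<close>, then \<open>g\<close> fixes the supremum \<open>d\<close> of the orbit of \<open>x\<close>, since the ladder of
  \<open>g d\<close> stays below \<open>d\<close>. So it fixes the ladder of \<open>d\<close>, which has elements above \<open>x\<close>; but the
  orbit of \<open>x\<close> cannot pass a fixed point.\<close>

lemma ladder_preserving_imp_id:
  fixes g :: "'x::{wellorder, order_top} \<Rightarrow> 'x"
  assumes mono: "strict_mono g"
    and lad: "\<And>d. ladder d (some_ladder d) \<Longrightarrow>
      ladder (g d) (some_ladder (g d)) \<and> (\<forall>n. g (some_ladder d n) = some_ladder (g d) n)"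
  shows "g x = x"
proof (rule ccontr)
  assume "g x \<noteq> x"
  with strict_mono_wellorder_increasing[OF mono, of x] have gx: "x < g x" by simp
  define orb where "orb k = (g ^^ k) x" for k
  have orb_Suc: "g (orb k) = orb (Suc k)" for k by (simp add: orb_def)
  have orb_less: "orb k < orb (Suc k)" for k
  proof (induction k)
    case (Suc k)
    then have "g (orb k) < g (orb (Suc k))" using mono by (simp add: strict_mono_less)
    then show ?case by (simp add: orb_Suc)
  qed (simp add: orb_def gx)
  define d where "d = (LEAST d. \<forall>k. orb k \<le> d)"
  have "\<forall>k. orb k \<le> top" by simp
  then have "orb k \<le> d" for k unfolding d_def by (rule LeastI2) simp
  then have orb_d: "orb k < d" for k using orb_less less_le_trans by blast
  have below_d: "\<exists>k. y < orb k" if "y < d" for y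
    using not_less_Least[OF that[unfolded d_def]] by (auto simp: not_le)
  have "ladder d orb" using orb_d below_d by (simp add: ladder_def) (meson less_imp_le)
  then have s: "ladder d (some_ladder d)" by (rule ladder_some_ladder)
  have g_d: "g y < d" if y: "y < d" for y
  proof -
    obtain k where "y < orb k" using below_d[OF y] ..
    then have "g y < orb (Suc k)" using mono by (simp add: strict_mono_less flip: orb_Suc)
    then show ?thesis using orb_d less_trans by blast
  qed
  have "some_ladder (g d) n < d" for n
    using lad[OF s] s g_d by (metis ladder_def)
  then have "\<not> d < g d" using lad[OF s] by (metis ladder_def not_le)
  then have "g d = d" using strict_mono_wellorder_increasing[OF mono, of d] by simp
  then have fixed: "g (some_ladder d n) = some_ladder d n" for n using lad[OF s] by simp
  obtain n where n: "x \<le> some_ladder d n" using s orb_d[of 0] by (auto simp: ladder_def orb_def)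
  have "orb k \<le> some_ladder d n" for k
  proof (induction k)
    case (Suc k)
    then have "g (orb k) \<le> g (some_ladder d n)" using mono by (simp add: strict_mono_less_eq)
    then show ?case by (simp add: orb_Suc fixed)
  qed (simp add: orb_def n)
  moreover have "\<exists>k. some_ladder d n < orb k" using below_d s by (auto simp: ladder_def)
  ultimately show False by (auto simp: not_less[symmetric])
qed

section \<open>A rigid family of segment systems\<close>

text \<open>Only the steps from \<open>(x, n)\<close> to \<open>(x, n + 2)\<close>, the marker \<open>m\<close> and the full segment are
  doubled. The steps make an embedding commute with \<open>(x, n) \<mapsto> (x, n + 1)\<close>, the segments \<open>base\<close>
  make it preserve the second component, and the second component of the upper end of \<open>rung\<close>
  records the position on the ladder.\<close>

inductive_set system :: "'x::wellorder \<Rightarrow> ('x \<times> nat) extended segment set" for m :: 'x where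
  point: "(c, c, False) \<in> system m"
| upper: "c \<noteq> Pinf \<Longrightarrow> (c, Pinf, False) \<in> system m"
| full: "(Minf, Pinf, True) \<in> system m"
| marker: "(Fin (m, 0), Pinf, True) \<in> system m"
| step: "(Fin (x, n), Fin (x, Suc (Suc n)), k) \<in> system m"
| base: "(Minf, Fin (x, 1), False) \<in> system m"
| rung: "ladder d (some_ladder d) \<Longrightarrow> (Fin (some_ladder d n, 1), Fin (d, n), False) \<in> system m"

text \<open>\<open>Fin (x, Suc n)\<close> covers \<open>Fin (x, n)\<close>, and
  \<open>Fin (x, 0)\<close> covers \<open>Minf\<close> for the least \<open>x\<close>; hence steps
  advance by two and \<open>base\<close> ends at level 1.\<close>

lemma between_extended_pairs:
  "c \<noteq> Pinf \<Longrightarrow> \<exists>z. c < z \<and> z < (Pinf :: ('x::linorder \<times> nat) extended)"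
  "\<exists>z. Fin (x, n) < z \<and> z < Fin (x::'x, Suc (Suc n))"
  "\<exists>z. Minf < z \<and> z < Fin (x::'x, Suc 0)"
  "x < y \<Longrightarrow> \<exists>z. Fin (x::'x, k) < z \<and> z < Fin (y, n)"
proof -
  show "\<exists>z. c < z \<and> z < (Pinf :: ('x \<times> nat) extended)" if "c \<noteq> Pinf"
  proof (cases c)
    case (Fin p)
    then show ?thesis by (intro exI[of _ "Fin (fst p, Suc (snd p))"]) (cases p, simp)
  qed (use that in \<open>auto intro: exI[of _ "Fin undefined"]\<close>)
  show "\<exists>z. Fin (x, n) < z \<and> z < Fin (x::'x, Suc (Suc n))"
    by (rule exI[of _ "Fin (x, Suc n)"]) simp
  show "\<exists>z. Minf < z \<and> z < Fin (x::'x, Suc 0)"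
    by (rule exI[of _ "Fin (x, 0)"]) simp
  show "\<exists>z. Fin (x::'x, k) < z \<and> z < Fin (y, n)" if "x < y"
    using that by (intro exI[of _ "Fin (x, Suc k)"]) simp
qed

lemma seg_system_system:
  assumes "inj \<phi>"
  shows "seg_system (system m) \<phi>"
proof
  show "pt c \<in> system m" for c by (simp add: pt_def system.point)
  show "a = b \<and> \<not> k \<or> (\<exists>z. a < z \<and> z < b)" if "(a, b, k) \<in> system m" for a b k
    using that
    by cases (auto intro!: between_extended_pairs simp: ladder_def)
qed (use assms in \<open>auto intro: system.intros\<close>)

lemma embedding_system_imp_eq:
  fixes m m' :: "'x::{wellorder, order_top}"
  assumes \<phi>: "inj \<phi>"
    and f: "zero_one_embedding (\<phi> ` system m) (coded_le \<phi>) (\<phi> ` system m') (coded_le \<phi>) f"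
  shows "m = m'"
proof -
  obtain g where mono: "strict_mono g" and bot: "g Minf = Minf" and top: "g Pinf = Pinf"
    and one: "\<And>a b k. (a, b, k) \<in> system m \<Longrightarrow> a < b \<Longrightarrow> \<exists>k'. (g a, g b, k') \<in> system m'"
    and two: "\<And>a b k. (a, b, False) \<in> system m \<Longrightarrow> (a, b, True) \<in> system m \<Longrightarrow> (g a, g b, k) \<in> system m'"
    using embedding_chain_map[OF seg_system_system[OF \<phi>] seg_system_system[OF \<phi>] f] by metis
  have g_less: "g a < g b \<longleftrightarrow> a < b" for a b using mono by (simp add: strict_mono_less)
  have "\<exists>q. g (Fin p) = Fin q" for p
    using g_less[of Minf "Fin p"] g_less[of "Fin p" Pinf] bot top by (cases "g (Fin p)") auto
  then obtain G where G: "g (Fin p) = Fin (G p)" for p by metis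
  have G_less: "G p < G q \<longleftrightarrow> p < q" for p q using g_less[of "Fin p" "Fin q"] by (simp add: G)
  have G_Suc2: "G (x, Suc (Suc n)) = (fst (G (x, n)), Suc (Suc (snd (G (x, n)))))" for x n
  proof -
    \<comment> \<open>With \<open>True\<close> and two \<open>Fin\<close> ends, only a step is
      possible.\<close>
    have "(Fin (G (x, n)), Fin (G (x, Suc (Suc n))), True) \<in> system m'"
      using two[OF system.step system.step, of x n True] by (simp add: G)
    then show ?thesis by cases auto
  qed
  have G_Suc: "G (x, Suc n) = (fst (G (x, n)), Suc (snd (G (x, n))))" for x n
  proof -
    \<comment> \<open>Only one pair lies strictly between \<open>(y, k)\<close> and
      \<open>(y, k + 2)\<close>.\<close>
    have "G (x, n) < G (x, Suc n)" "G (x, Suc n) < G (x, Suc (Suc n))" by (simp_all add: G_less)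
    then show ?thesis unfolding G_Suc2
      by (cases "G (x, n)"; cases "G (x, Suc n)") (auto simp: less_prod_def')
  qed
  define \<gamma> where "\<gamma> x = fst (G (x, 0))" for x
  have G_0: "G (x, 0) = (\<gamma> x, 0)" for x
  proof -
    \<comment> \<open>Only \<open>base\<close> runs from \<open>Minf\<close> to a \<open>Fin\<close>
      point, which fixes the level of the image.\<close>
    obtain k where "(Minf, Fin (G (x, Suc 0)), k) \<in> system m'"
      using one[OF system.base, of x] by (auto simp: G bot)
    then have "snd (G (x, Suc 0)) = Suc 0" by cases auto
    then show ?thesis by (simp add: G_Suc \<gamma>_def prod_eq_iff)
  qed
  have G_eq: "G (x, n) = (\<gamma> x, n)" for x n
    by (induction n) (simp_all add: G_0 G_Suc)
  have \<gamma>_mono: "strict_mono \<gamma>"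
  proof (rule strict_monoI)
    fix x y :: 'x assume "x < y"
    then have "G (x, 0) < G (y, 0)" by (simp add: G_less)
    then show "\<gamma> x < \<gamma> y" by (auto simp: G_eq less_prod_def')
  qed
  have "\<gamma> x = x" for x
  proof (rule ladder_preserving_imp_id[OF \<gamma>_mono])
    fix d :: 'x assume d: "ladder d (some_ladder d)"
    have "ladder (\<gamma> d) (some_ladder (\<gamma> d)) \<and> \<gamma> (some_ladder d n) = some_ladder (\<gamma> d) n" for n
    proof -
      have less: "some_ladder d n < d" using d by (simp add: ladder_def)
      then have "\<gamma> (some_ladder d n) \<noteq> \<gamma> d" using \<gamma>_mono by (auto simp: strict_mono_less dest: strict_monoD)
      \<comment> \<open>Points and steps have equal first components, so this is a rung, and the
        level \<open>n\<close> of its upper end forces the same ladder index.\<close>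
      moreover obtain k where "(Fin (\<gamma> (some_ladder d n), 1), Fin (\<gamma> d, n), k) \<in> system m'"
        using one[OF system.rung[OF d]] less by (auto simp: G G_eq)
      ultimately show ?thesis by (auto elim: system.cases)
    qed
    then show "ladder (\<gamma> d) (some_ladder (\<gamma> d)) \<and> (\<forall>n. \<gamma> (some_ladder d n) = some_ladder (\<gamma> d) n)"
      by blast
  qed
  \<comment> \<open>A \<open>True\<close> element from a \<open>Fin\<close> point to
    \<open>Pinf\<close> must be the marker of \<open>system m'\<close>.\<close>
  moreover have "(Fin (\<gamma> m, 0), Pinf, True) \<in> system m'"
    using two[OF system.upper system.marker, of True] by (simp add: G G_eq top)
  then have "\<gamma> m = m'" by cases auto
  ultimately show ?thesis by simp
qed

section \<open>A well-ordered type with a greatest element\<close>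

definition some_wo :: "'a rel" where
  "some_wo = (SOME r. well_order r)"

lemma well_order_some_wo: "well_order (some_wo :: 'a rel)"
  unfolding some_wo_def by (rule someI_ex[OF well_order_on])

text \<open>\<open>Top\<close> bounds every orbit, as the rigidity argument requires; a well-order
  of \<open>'a\<close> itself may have no greatest element.\<close>

datatype 'a wo = Pt 'a | Top

instantiation wo :: (type) linorder
begin

definition less_eq_wo :: "'a wo \<Rightarrow> 'a wo \<Rightarrow> bool" where
  "less_eq_wo x y \<longleftrightarrow> (case y of Top \<Rightarrow> True | Pt b \<Rightarrow> (case x of Top \<Rightarrow> False | Pt a \<Rightarrow> (a, b) \<in> some_wo))"

definition less_wo :: "'a wo \<Rightarrow> 'a wo \<Rightarrow> bool" where
  "less_wo x y \<longleftrightarrow> x \<le> y \<and> x \<noteq> y"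

instance
proof
  have wo: "refl (some_wo :: 'a rel)" "trans (some_wo :: 'a rel)" "antisym (some_wo :: 'a rel)"
    "total (some_wo :: 'a rel)"
    using well_order_some_wo[where 'a = 'a] by (auto simp: order_on_defs)
  fix x y z :: "'a wo"
  show refl: "x \<le> x"
    using wo(1) by (auto simp: less_eq_wo_def refl_on_def split: wo.split)
  show "x \<le> y \<Longrightarrow> y \<le> z \<Longrightarrow> x \<le> z"
    using wo(2) by (auto simp: less_eq_wo_def split: wo.splits dest: transD)
  show antisym: "x \<le> y \<Longrightarrow> y \<le> x \<Longrightarrow> x = y"
    using wo(3) by (auto simp: less_eq_wo_def split: wo.splits dest: antisymD)
  show "x < y \<longleftrightarrow> x \<le> y \<and> \<not> y \<le> x"
    using refl antisym by (auto simp: less_wo_def)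
  show "x \<le> y \<or> y \<le> x"
    using wo(1,4) by (cases x; cases y) (force simp: less_eq_wo_def total_on_def refl_on_def)+
qed

end

instantiation wo :: (type) order_top
begin

definition top_wo :: "'a wo" where
  "top_wo = Top"

instance by standard (simp add: top_wo_def less_eq_wo_def)

end

instance wo :: (type) wellorder
proof
  fix P :: "'a wo \<Rightarrow> bool" and z
  assume P: "\<And>x. (\<And>y. y < x \<Longrightarrow> P y) \<Longrightarrow> P x"
  have wf: "wf (some_wo - Id :: 'a rel)"
    using well_order_some_wo[where 'a = 'a] by (simp add: well_order_on_def)
  have Pt: "P (Pt a)" for a
  proof (induction a rule: wf_induct_rule[OF wf])
    case (1 a)
    show ?case
    proof (rule P)
      fix y assume "y < Pt a"
      then show "P y" using 1 by (cases y) (auto simp: less_wo_def less_eq_wo_def)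
    qed
  qed
  have "P y" if "y < Top" for y
    using Pt that by (cases y) (auto simp: less_wo_def)
  with P have "P Top" by blast
  with Pt show "P z" by (cases z) auto
qed

text \<open>As \<open>'i + nat\<close> is infinite, it has an injective pairing \<open>p\<close>;
  nested pairs code the segments, and singletons lift the codes to sets.\<close>

lemma ex_inj_segment_code:
  "\<exists>\<phi> :: ('i wo \<times> nat) extended segment \<Rightarrow> ('i + nat) set. inj \<phi>"
proof -
  have "infinite (UNIV :: ('i + nat) set)" by (simp add: finite_Plus_UNIV_iff)
  from card_of_Times_same_infinite[OF this]
  obtain p :: "('i + nat) \<times> ('i + nat) \<Rightarrow> 'i + nat" where p: "inj p"
    by (auto simp flip: card_of_ordIso simp: bij_betw_def)
  then have p_eq: "p u = p v \<longleftrightarrow> u = v" for u v by (auto dest: injD)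
  define w :: "'i wo \<Rightarrow> 'i + nat" where "w = case_wo Inl (Inr 0)"
  have w: "w x = w y \<longleftrightarrow> x = y" for x y by (auto simp: w_def split: wo.splits)
  define c where "c a = (case a of Minf \<Rightarrow> p (Inr 0, Inr 0) | Pinf \<Rightarrow> p (Inr 0, Inr 1)
    | Fin (x, n) \<Rightarrow> p (Inr 1, p (w x, Inr n)))" for a :: "('i wo \<times> nat) extended"
  have c: "c a = c b \<longleftrightarrow> a = b" for a b by (auto simp: c_def p_eq w split: extended.splits)
  have "inj (\<lambda>(a, b, k). {p (p (c a, c b), Inr (of_bool k))})"
    by (auto simp: inj_def p_eq c)
  then show ?thesis by blast
qed

theorem theorem2:
  fixes I :: "'i set"
  shows "\<exists>K :: 'i \<Rightarrow> (('i + nat) set set \<times> (('i + nat) set \<Rightarrow> ('i + nat) set \<Rightarrow> bool)).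
           (\<forall>i\<in>I. bounded_lattice (fst (K i)) (snd (K i)) \<and>
                   simple_lattice (fst (K i)) (snd (K i))) \<and>
           (\<forall>i\<in>I. \<forall>j\<in>I. i \<noteq> j \<longrightarrow>
              \<not> (\<exists>f. zero_one_embedding (fst (K i)) (snd (K i)) (fst (K j)) (snd (K j)) f))"
proof -
  obtain \<phi> :: "('i wo \<times> nat) extended segment \<Rightarrow> ('i + nat) set" where \<phi>: "inj \<phi>"
    using ex_inj_segment_code by blast
  \<comment> \<open>Only the position of the marker depends on \<open>i\<close>.\<close>
  let ?K = "\<lambda>i. (\<phi> ` system (Pt i), coded_le \<phi>)"
  show ?thesis
    using seg_system.bounded_lattice_code[OF seg_system_system[OF \<phi>]]
      seg_system.simple_lattice_code[OF seg_system_system[OF \<phi>]]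
    by (intro exI[of _ ?K]) (auto dest: embedding_system_imp_eq[OF \<phi>])
qed

end
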